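(* The fundamental quandle $Q(3_1)$ of the trefoil knot is isomorphic to the quandle of fractions $(\mathbb{Q}\cup\{\tfrac10\},* )$, where $$\frac{p}{q}*\frac{s}{t}=\frac{p-Ds}{q-Dt},\qquad D=pt-qs .$$ The isomorphism $\phi:Q(3_1)\to(\mathbb{Q}\cup\{\tfrac10\},* )$ is given on generators by $\phi(a)=\tfrac01$, $\phi(b)=\tfrac10$.
   Context: A quandle is a set $X$ with a binary operation $*$ such that: (1) $x*x=x$ for all $x\in X$; (2) for all $x,y\in X$ there is a unique $z\in X$ with $x=z*y$; (3) $(x*y)*z=(x*z)*(y*z)$ for all $x,y,z\in X$. Unparenthesized products are read left to right: $x*y*z=(x*y)*z$. An isomorphism of quandles is a bijection $f$ with $f(x*y)=f(x)*f(y)$. The fundamental quandle of the trefoil knot is the quandle with presentation (in the category of quandles) $Q(3_1)=\langle a,b \mid a*b*a=b,\ b*a*b=a\rangle$. An element $\frac{p}{q}$ of $\mathbb{Q}\cup\{\frac10\}$ is identified with a relatively prime pair $\pm(p,q)\in(\mathbb{Z}\oplus\mathbb{Z})/\{\pm1\}$, i.e. pairs $(p,q)$ and $(-p,-q)$ are identified; the fractions in the formula for $*$ are written using such relatively prime representatives (the result does not depend on the choice of signs). This quandle is the projective primitive subquandle of the symplectic quandle on $\mathbb{Z}\oplus\mathbb{Z}$, whose operation is $x*y=x-\langle x,y\rangle y$ with $\langle (p,q),(s,t)\rangle=pt-qs$. *)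

theory Defs
  imports Main
begin

section \<open>Quandles\<close>

locale quandle =
  fixes X :: "'a set" and qop :: "'a \<Rightarrow> 'a \<Rightarrow> 'a" (infixl "\<star>" 70)
  assumes closed: "x \<in> X \<Longrightarrow> y \<in> X \<Longrightarrow> x \<star> y \<in> X"
    and idem: "x \<in> X \<Longrightarrow> x \<star> x = x"
    and right_div: "x \<in> X \<Longrightarrow> y \<in> X \<Longrightarrow> \<exists>!z. z \<in> X \<and> x = z \<star> y"
    and self_distrib:
      "x \<in> X \<Longrightarrow> y \<in> X \<Longrightarrow> z \<in> X \<Longrightarrow> (x \<star> y) \<star> z = (x \<star> z) \<star> (y \<star> z)"

locale quandle_hom =
  source: quandle X qop + target: quandle Y qop'
  for X :: "'a set" and qop :: "'a \<Rightarrow> 'a \<Rightarrow> 'a" (infixl "\<star>" 70)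
    and Y :: "'b set" and qop' :: "'b \<Rightarrow> 'b \<Rightarrow> 'b" (infixl "\<star>''" 70) +
  fixes f :: "'a \<Rightarrow> 'b"
  assumes maps_to: "x \<in> X \<Longrightarrow> f x \<in> Y"
    and hom: "x \<in> X \<Longrightarrow> y \<in> X \<Longrightarrow> f (x \<star> y) = f x \<star>' f y"

locale quandle_iso = quandle_hom +
  assumes bij: "bij_betw f X Y"


section \<open>Presentations of quandles\<close>

text \<open>
  \<open>Div x y\<close> stands for the unique \<open>z\<close> with \<open>x = z * y\<close>, so that quandles become an
  equational class with two binary operations. The quandle presented by generators
  \<open>'g\<close> and relations \<open>R\<close> is the algebra of terms modulo the least congruence that
  contains \<open>R\<close> and all instances of the quandle axioms.
\<close>

datatype 'g qterm = Gen 'g | Op "'g qterm" "'g qterm" | Div "'g qterm" "'g qterm"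

inductive qcong :: "('g qterm \<times> 'g qterm) set \<Rightarrow> 'g qterm \<Rightarrow> 'g qterm \<Rightarrow> bool"
  for R :: "('g qterm \<times> 'g qterm) set" where
  rel: "(s, t) \<in> R \<Longrightarrow> qcong R s t"
| refl: "qcong R t t"
| sym: "qcong R s t \<Longrightarrow> qcong R t s"
| trans: "qcong R s t \<Longrightarrow> qcong R t u \<Longrightarrow> qcong R s u"
| Op_cong: "qcong R s s' \<Longrightarrow> qcong R t t' \<Longrightarrow> qcong R (Op s t) (Op s' t')"
| Div_cong: "qcong R s s' \<Longrightarrow> qcong R t t' \<Longrightarrow> qcong R (Div s t) (Div s' t')"
| idem: "qcong R (Op t t) t"
| Op_Div: "qcong R (Op (Div s t) t) s"
| Div_Op: "qcong R (Div (Op s t) t) s"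
| distrib: "qcong R (Op (Op s t) u) (Op (Op s u) (Op t u))"

definition qclass :: "('g qterm \<times> 'g qterm) set \<Rightarrow> 'g qterm \<Rightarrow> 'g qterm set" where
  "qclass R t = {(s, t). qcong R s t} `` {t}"

definition presented_quandle :: "('g qterm \<times> 'g qterm) set \<Rightarrow> 'g qterm set set" where
  "presented_quandle R = UNIV // {(s, t). qcong R s t}"

definition presented_op ::
  "('g qterm \<times> 'g qterm) set \<Rightarrow> 'g qterm set \<Rightarrow> 'g qterm set \<Rightarrow> 'g qterm set" where
  "presented_op R A B = (\<Union>s\<in>A. \<Union>t\<in>B. qclass R (Op s t))"

lemma qclass_eq_iff: "qclass R s = qclass R t \<longleftrightarrow> qcong R s t"
  unfolding qclass_def by (auto intro: qcong.refl qcong.sym qcong.trans)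

lemma presented_quandle_eq: "presented_quandle R = range (qclass R)"
  unfolding presented_quandle_def qclass_def quotient_def by auto

lemma presented_op_qclass: "presented_op R (qclass R s) (qclass R t) = qclass R (Op s t)"
proof -
  have "qclass R (Op s' t') = qclass R (Op s t)" if "s' \<in> qclass R s" "t' \<in> qclass R t" for s' t'
    using that unfolding qclass_eq_iff by (auto simp: qclass_def intro: qcong.intros)
  moreover have "s \<in> qclass R s" "t \<in> qclass R t"
    by (auto simp: qclass_def intro: qcong.refl)
  ultimately show ?thesis
    unfolding presented_op_def by blast
qed

lemma quandle_presented: "quandle (presented_quandle R) (presented_op R)"
proof
  fix x y assume "x \<in> presented_quandle R" "y \<in> presented_quandle R"
  then obtain s t where st: "x = qclass R s" "y = qclass R t"
    by (auto simp: presented_quandle_eq)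
  show "presented_op R x y \<in> presented_quandle R"
    by (simp add: st presented_op_qclass presented_quandle_eq)
  show "\<exists>!z. z \<in> presented_quandle R \<and> x = presented_op R z y"
  proof (rule ex1I[of _ "qclass R (Div s t)"])
    show "qclass R (Div s t) \<in> presented_quandle R \<and> x = presented_op R (qclass R (Div s t)) y"
      by (auto simp: st presented_op_qclass presented_quandle_eq qclass_eq_iff
          intro: qcong.sym qcong.Op_Div)
  next
    fix z assume z: "z \<in> presented_quandle R \<and> x = presented_op R z y"
    then obtain u where u: "z = qclass R u"
      by (auto simp: presented_quandle_eq)
    from z have "qcong R s (Op u t)"
      by (simp add: st u presented_op_qclass qclass_eq_iff)
    then have "qcong R (Div s t) u"
      by (meson qcong.Div_cong qcong.Div_Op qcong.refl qcong.trans)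
    then show "z = qclass R (Div s t)"
      by (simp add: u qclass_eq_iff qcong.sym)
  qed
next
  fix x assume "x \<in> presented_quandle R"
  then obtain t where "x = qclass R t"
    by (auto simp: presented_quandle_eq)
  then show "presented_op R x x = x"
    by (simp add: presented_op_qclass qclass_eq_iff qcong.idem)
next
  fix x y z assume "x \<in> presented_quandle R" "y \<in> presented_quandle R" "z \<in> presented_quandle R"
  then obtain s t u where "x = qclass R s" "y = qclass R t" "z = qclass R u"
    by (auto simp: presented_quandle_eq)
  then show "presented_op R (presented_op R x y) z =
      presented_op R (presented_op R x z) (presented_op R y z)"
    by (simp add: presented_op_qclass qclass_eq_iff qcong.distrib)
qed

text \<open>The universal property of the presentation.\<close>

context quandle
begin

definition qdiv :: "'a \<Rightarrow> 'a \<Rightarrow> 'a" where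
  "qdiv x y = (THE z. z \<in> X \<and> x = z \<star> y)"

primrec qeval :: "('g \<Rightarrow> 'a) \<Rightarrow> 'g qterm \<Rightarrow> 'a" where
  "qeval h (Gen g) = h g"
| "qeval h (Op s t) = qeval h s \<star> qeval h t"
| "qeval h (Div s t) = qdiv (qeval h s) (qeval h t)"

lemma qdiv:
  assumes "x \<in> X" "y \<in> X"
  shows "qdiv x y \<in> X" "qdiv x y \<star> y = x"
  using theI'[OF right_div[OF assms]] by (auto simp: qdiv_def)

lemma qdiv_unique: "z \<in> X \<Longrightarrow> y \<in> X \<Longrightarrow> qdiv (z \<star> y) y = z"
  using right_div[of "z \<star> y" y] qdiv[of "z \<star> y" y] closed[of z y] by metis

lemma qeval_closed: "(\<And>g. h g \<in> X) \<Longrightarrow> qeval h t \<in> X"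
  by (induction t) (auto intro: closed qdiv)

lemma qeval_cong:
  assumes "qcong R s t" "\<And>g. h g \<in> X" "\<And>s t. (s, t) \<in> R \<Longrightarrow> qeval h s = qeval h t"
  shows "qeval h s = qeval h t"
  using assms(1)
  by induction (auto simp: assms(3) qeval_closed assms(2) idem qdiv qdiv_unique intro: self_distrib)

lemma presented_universal:
  assumes "\<And>g. h g \<in> X" "\<And>s t. (s, t) \<in> R \<Longrightarrow> qeval h s = qeval h t"
  shows "\<exists>f. quandle_hom (presented_quandle R) (presented_op R) X (\<star>) f \<and>
    (\<forall>g. f (qclass R (Gen g)) = h g)"
proof -
  define f where "f A = qeval h (SOME s. s \<in> A)" for A
  have f: "f (qclass R t) = qeval h t" for t
  proof -
    have "(SOME s. s \<in> qclass R t) \<in> qclass R t"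
      by (rule someI[of _ t]) (simp add: qclass_def qcong.refl)
    then have "qcong R t (SOME s. s \<in> qclass R t)"
      by (simp add: qclass_def)
    from qeval_cong[OF this assms] show ?thesis
      by (simp add: f_def)
  qed
  interpret P: quandle "presented_quandle R" "presented_op R"
    by (rule quandle_presented)
  have "quandle_hom (presented_quandle R) (presented_op R) X (\<star>) f"
    by unfold_locales
      (auto simp: presented_quandle_eq presented_op_qclass f qeval_closed assms(1))
  with f show ?thesis by auto
qed

end

lemma presented_hom_unique:
  assumes "quandle_hom (presented_quandle R) (presented_op R) Y qop' f"
    and "quandle_hom (presented_quandle R) (presented_op R) Y qop' f'"
    and gen: "\<And>g. f (qclass R (Gen g)) = f' (qclass R (Gen g))"
    and "x \<in> presented_quandle R"
  shows "f x = f' x"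
proof -
  interpret f: quandle_hom "presented_quandle R" "presented_op R" Y qop' f by fact
  interpret f': quandle_hom "presented_quandle R" "presented_op R" Y qop' f' by fact
  have mem: "qclass R t \<in> presented_quandle R" for t
    by (simp add: presented_quandle_eq)
  have "f (qclass R t) = f' (qclass R t)" for t
  proof (induction t)
    case (Gen g)
    show ?case by (rule gen)
  next
    case (Op s t)
    then show ?case
      using f.hom[OF mem mem, of s t] f'.hom[OF mem mem, of s t] by (simp add: presented_op_qclass)
  next
    case (Div s t)
    have "qclass R s = presented_op R (qclass R (Div s t)) (qclass R t)"
      by (simp add: presented_op_qclass qclass_eq_iff qcong.Op_Div qcong.sym)
    then have "f (qclass R s) = qop' (f (qclass R (Div s t))) (f (qclass R t))"
      "f' (qclass R s) = qop' (f' (qclass R (Div s t))) (f' (qclass R t))"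
      using f.hom f'.hom mem by metis+
    with Div f.target.right_div[OF f.maps_to[OF mem] f.maps_to[OF mem], of s t]
    show ?case using f.maps_to f'.maps_to mem by metis
  qed
  with assms(4) show ?thesis by (auto simp: presented_quandle_eq)
qed


section \<open>The fundamental quandle of the trefoil\<close>

datatype trefoil_gen = Gen_a | Gen_b

definition trefoil_rels :: "(trefoil_gen qterm \<times> trefoil_gen qterm) set" where
  "trefoil_rels =
    {(Op (Op (Gen Gen_a) (Gen Gen_b)) (Gen Gen_a), Gen Gen_b),
     (Op (Op (Gen Gen_b) (Gen Gen_a)) (Gen Gen_b), Gen Gen_a)}"

definition trefoil_quandle :: "trefoil_gen qterm set set" where
  "trefoil_quandle = presented_quandle trefoil_rels"

definition trefoil_op ::
  "trefoil_gen qterm set \<Rightarrow> trefoil_gen qterm set \<Rightarrow> trefoil_gen qterm set" where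
  "trefoil_op = presented_op trefoil_rels"

definition trefoil_a :: "trefoil_gen qterm set" where
  "trefoil_a = qclass trefoil_rels (Gen Gen_a)"

definition trefoil_b :: "trefoil_gen qterm set" where
  "trefoil_b = qclass trefoil_rels (Gen Gen_b)"


section \<open>The quandle of fractions\<close>

text \<open>
  For coprime \<open>p\<close> and \<open>q\<close>, the fraction \<open>p/q\<close> (including \<open>1/0\<close>) is the pair
  \<open>(p, q)\<close> up to a common sign.
\<close>

definition fraction :: "int \<Rightarrow> int \<Rightarrow> (int \<times> int) set" where
  "fraction p q = {(p, q), (- p, - q)}"

definition fractions :: "(int \<times> int) set set" where
  "fractions = {fraction p q | p q. coprime p q}"

definition fraction_op :: "(int \<times> int) set \<Rightarrow> (int \<times> int) set \<Rightarrow> (int \<times> int) set" where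
  "fraction_op A B =
    (\<Union>(p, q)\<in>A. \<Union>(s, t)\<in>B. let D = p * t - q * s in fraction (p - D * s) (q - D * t))"

lemma fraction_eq_iff: "fraction p q = fraction s t \<longleftrightarrow> p = s \<and> q = t \<or> p = - s \<and> q = - t"
  unfolding fraction_def by (auto simp: doubleton_eq_iff)

lemma fraction_eq_iff_cross_mult:
  assumes "coprime p q" "coprime s t"
  shows "fraction p q = fraction s t \<longleftrightarrow> p * t = s * q"
proof
  assume *: "p * t = s * q"
  then have "\<bar>p\<bar> * \<bar>t\<bar> = \<bar>s\<bar> * \<bar>q\<bar>"
    by (metis abs_mult)
  with assms have "\<bar>p\<bar> = \<bar>s\<bar>" "\<bar>t\<bar> = \<bar>q\<bar>"
    using coprime_crossproduct_int[of p q s t] by (auto simp: coprime_commute)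
  with * show "fraction p q = fraction s t"
    unfolding fraction_eq_iff by (auto simp: abs_eq_iff)
qed (auto simp: fraction_eq_iff)

lemma fraction_op_fraction:
  "fraction_op (fraction p q) (fraction s t) =
    (let D = p * t - q * s in fraction (p - D * s) (q - D * t))"
  unfolding fraction_op_def by (auto simp: fraction_def Let_def algebra_simps)

lemma coprime_transvection:
  fixes p q s t c :: int
  assumes "coprime p q" "c = p * t - q * s \<or> c = - (p * t - q * s)"
  shows "coprime (p - c * s) (q - c * t)"
proof (rule coprimeI)
  fix d assume d: "d dvd p - c * s" "d dvd q - c * t"
  have "p * t - q * s = (p - c * s) * t - (q - c * t) * s"
    by (simp add: algebra_simps)
  with d have "d dvd p * t - q * s"
    by (metis dvd_diff dvd_mult2)
  with assms(2) have "d dvd c"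
    by (metis dvd_minus_iff)
  with d have "d dvd p" "d dvd q"
    by (metis dvd_mult2 dvd_diff_left_iff diff_add_cancel dvd_add)+
  with assms(1) show "is_unit d"
    by (rule coprime_common_divisor)
qed

lemma quandle_fractions: "quandle fractions fraction_op"
proof
  fix x y assume "x \<in> fractions" "y \<in> fractions"
  then obtain p q s t where
    xy: "x = fraction p q" "coprime p q" "y = fraction s t" "coprime s t"
    by (auto simp: fractions_def)
  let ?D = "p * t - q * s"
  show "fraction_op x y \<in> fractions"
    using coprime_transvection[OF xy(2), of ?D t s]
    by (auto simp: xy fraction_op_fraction Let_def fractions_def)
  show "\<exists>!z. z \<in> fractions \<and> x = fraction_op z y"
  proof (rule ex1I[of _ "fraction (p + ?D * s) (q + ?D * t)"])
    have "coprime (p + ?D * s) (q + ?D * t)"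
      using coprime_transvection[OF xy(2), of "- ?D" t s]
      by (simp only: mult_minus_left diff_minus_eq_add simp_thms)
    moreover have "(p + ?D * s) * t - (q + ?D * t) * s = ?D"
      by (simp add: algebra_simps)
    then have "fraction_op (fraction (p + ?D * s) (q + ?D * t)) y = x"
      by (simp add: xy fraction_op_fraction)
    ultimately show "fraction (p + ?D * s) (q + ?D * t) \<in> fractions \<and>
        x = fraction_op (fraction (p + ?D * s) (q + ?D * t)) y"
      by (auto simp: fractions_def)
  next
    fix z assume z: "z \<in> fractions \<and> x = fraction_op z y"
    then obtain u v where uv: "z = fraction u v"
      by (auto simp: fractions_def)
    define E where "E = u * t - v * s"
    from z have "p = u - E * s \<and> q = v - E * t \<or> p = - (u - E * s) \<and> q = - (v - E * t)"
      unfolding uv xy fraction_op_fraction Let_def E_def by (simp add: fraction_eq_iff)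
    then show "z = fraction (p + ?D * s) (q + ?D * t)"
    proof (elim disjE conjE)
      assume pq: "p = u - E * s" "q = v - E * t"
      have "?D = E"
        unfolding pq E_def by (simp add: algebra_simps)
      with pq show ?thesis
        by (simp add: uv)
    next
      assume pq: "p = - (u - E * s)" "q = - (v - E * t)"
      have "?D = - E"
        unfolding pq E_def by (simp add: algebra_simps)
      with pq show ?thesis
        by (simp add: uv fraction_eq_iff)
    qed
  qed
next
  fix x assume "x \<in> fractions"
  then show "fraction_op x x = x"
    by (auto simp: fractions_def fraction_op_fraction mult.commute)
next
  fix x y z assume "x \<in> fractions" "y \<in> fractions" "z \<in> fractions"
  then show "fraction_op (fraction_op x y) z = fraction_op (fraction_op x z) (fraction_op y z)"
    by (auto simp: fractions_def fraction_op_fraction Let_def fraction_eq_iff algebra_simps)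
qed

end

theory Submission
  imports Defs
begin

text \<open>
  The presentation gives a homomorphism \<open>\<phi>\<close> with \<open>a \<mapsto> 0/1\<close> and \<open>b \<mapsto> 1/0\<close>, because these two
  fractions satisfy the trefoil relations; the content of the theorem is that \<open>\<phi>\<close> is bijective.
  An inverse \<open>\<Psi>\<close> (\<open>slope_of\<close>) is built by the Euclidean algorithm. On fractions, right multiplication by
  \<open>1/0\<close> is the transvection \<open>(p, q) \<mapsto> (p + q, q)\<close>, and right division by \<open>0/1\<close> is
  \<open>(p, q) \<mapsto> (p, p + q)\<close>. So a fraction with nonnegative entries is obtained from \<open>0/1\<close> or \<open>1/0\<close> by
  the steps \<open>- * b\<close> and \<open>- / a\<close> in exactly the way in which subtractive Euclid runs backwards, and
  \<open>euclid p q\<close> is the result of performing these same steps in the trefoil quandle.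

  Negative fractions are reached by the half twist \<open>\<Delta> x = x * a * b * a\<close>, which is the image of the
  Garside element of the braid group on three strands and acts on fractions as the quarter turn
  \<open>(p, q) \<mapsto> (q, -p)\<close>. As a composite of right translations, \<open>\<Delta>\<close> is an
  endomorphism of the trefoil quandle, and by the relations it exchanges \<open>a\<close> and \<open>b\<close>. Hence
  \<open>\<Delta>\<^sup>2\<close> fixes the generators, so it is the identity: the centre of the braid group acts trivially,
  exactly as \<open>-1\<close> does on fractions. This makes it consistent to extend
  \<open>euclid\<close> to all fractions by \<open>\<Psi>(q, -p) = \<Delta> (\<Psi>(p, q))\<close>.

  Since \<open>\<Delta>\<close> turns right multiplication by \<open>a\<close> into right multiplication by \<open>b\<close>, one can check
  that \<open>\<Psi>\<close> intertwines right multiplication by the generators on both sides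
  (\<open>slope_mult_b\<close>, \<open>slope_mult_a\<close>). Since every right translation is determined by those of the generators, \<open>\<Psi>\<close> intertwines right multiplication by \<open>\<phi> y\<close> and by \<open>y\<close>
  for every \<open>y\<close> (\<open>slope_of_mult\<close>), which yields \<open>\<Psi> (\<phi> x) = x\<close>.
  The other identity \<open>\<phi> (\<Psi> F) = F\<close> follows by
  replaying the Euclidean algorithm under \<open>\<phi>\<close>.
\<close>

section \<open>Quandles generated by a trefoil pair\<close>

lemma (in quandle) right_cancel:
  "x \<in> X \<Longrightarrow> x' \<in> X \<Longrightarrow> y \<in> X \<Longrightarrow> x \<star> y = x' \<star> y \<Longrightarrow> x = x'"
  using qdiv_unique by metis

text \<open>
  The induction principle \<open>generated\<close> says that \<open>a\<close> and \<open>b\<close> generate the quandle under the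
  operation and its right division. The last premise is closure under division: \<open>x\<close> is the
  quotient of \<open>x \<star> y\<close> by \<open>y\<close>.
\<close>

locale trefoil_pair = quandle X qop
  for X :: "'a set" and qop :: "'a \<Rightarrow> 'a \<Rightarrow> 'a" (infixl "\<star>" 70) +
  fixes a b :: 'a
  assumes a_in: "a \<in> X" and b_in: "b \<in> X"
    and aba: "a \<star> b \<star> a = b" and bab: "b \<star> a \<star> b = a"
    and generated [consumes 1, case_names a b mult div]:
      "\<lbrakk>z \<in> X; P a; P b;
        \<And>x y. \<lbrakk>x \<in> X; y \<in> X; P x; P y\<rbrakk> \<Longrightarrow> P (x \<star> y);
        \<And>x y. \<lbrakk>x \<in> X; y \<in> X; P (x \<star> y); P y\<rbrakk> \<Longrightarrow> P x\<rbrakk> \<Longrightarrow> P z"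
begin

definition half_twist :: "'a \<Rightarrow> 'a" where
  "half_twist x = x \<star> a \<star> b \<star> a"

lemma half_twist_closed: "x \<in> X \<Longrightarrow> half_twist x \<in> X"
  by (simp add: half_twist_def closed a_in b_in)

lemma half_twist_mult:
  "x \<in> X \<Longrightarrow> y \<in> X \<Longrightarrow> half_twist (x \<star> y) = half_twist x \<star> half_twist y"
  by (simp add: half_twist_def closed a_in b_in
      self_distrib[OF _ _ a_in, symmetric] self_distrib[OF _ _ b_in, symmetric])

lemma half_twist_a: "half_twist a = b"
  by (simp add: half_twist_def idem a_in aba)

lemma half_twist_b: "half_twist b = a"
  by (simp add: half_twist_def bab idem a_in)

text \<open>
  Squared, the half twist is an endomorphism that fixes both generators.
\<close>

lemma half_twist_involutive:
  assumes "x \<in> X"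
  shows "half_twist (half_twist x) = x"
  using assms
proof (induction rule: generated)
  case a
  show ?case by (simp add: half_twist_a half_twist_b)
next
  case b
  show ?case by (simp add: half_twist_a half_twist_b)
next
  case (mult x y)
  then show ?case by (simp add: half_twist_mult half_twist_closed)
next
  case (div x y)
  then have "half_twist (half_twist x) \<star> y = x \<star> y"
    by (simp add: half_twist_mult half_twist_closed)
  with div show ?case
    using right_cancel half_twist_closed by meson
qed

text \<open>
  The consequence \<open>\<Delta> \<circ> A = B \<circ> \<Delta>\<close> of the braid relation between the right translations \<open>A\<close>
  and \<open>B\<close> by the two generators.
\<close>

lemma half_twist_mult_b: "x \<in> X \<Longrightarrow> half_twist x \<star> b = half_twist (x \<star> a)"
  by (simp add: half_twist_mult half_twist_a a_in)

lemma mult_b_mult_a: "x \<in> X \<Longrightarrow> x \<star> b \<star> a = half_twist (qdiv x a)"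
  by (simp add: half_twist_def qdiv a_in)


section \<open>The Euclidean algorithm in the quandle\<close>

fun euclid :: "nat \<Rightarrow> nat \<Rightarrow> 'a" where
  "euclid p q =
    (if p = 0 then a else if q = 0 then b
     else if q \<le> p then euclid (p - q) q \<star> b else qdiv (euclid p (q - p)) a)"

declare euclid.simps [simp del]

lemma euclid_0 [simp]: "euclid 0 q = a" "0 < p \<Longrightarrow> euclid p 0 = b"
  by (simp_all add: euclid.simps)

lemma euclid_closed: "euclid p q \<in> X"
proof (induction p q rule: euclid.induct)
  case (1 p q)
  then show ?case
    by (subst euclid.simps) (simp add: a_in b_in closed qdiv)
qed

lemma euclid_mult_b:
  assumes "0 < p \<or> 0 < q"
  shows "euclid p q \<star> b = euclid (p + q) q"
  using assms by (cases "q = 0") (simp_all add: idem b_in euclid.simps[of "p + q" q])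

text \<open>
  The diagonal \<open>p = q\<close> is where the two Euclidean steps compete: \<open>euclid\<close> writes \<open>1/1\<close> as
  \<open>a * b\<close>, and the relation \<open>a * b * a = b\<close> says that this is also \<open>b / a\<close>.
\<close>

lemma euclid_mult_a: "euclid p (p + q) \<star> a = euclid p q"
  using qdiv[OF euclid_closed a_in, of p q]
  by (cases "p = 0"; cases "q = 0")
    (simp_all add: idem a_in aba euclid.simps[of p p] euclid.simps[of p "p + q"])

text \<open>
  The sign of \<open>p * q\<close> tells whether \<open>\<plusminus>(p, q)\<close> has a representative with nonnegative entries; if
  not, it is the quarter turn of \<open>(\<bar>q\<bar>, \<bar>p\<bar>)\<close>.
\<close>

definition slope :: "int \<Rightarrow> int \<Rightarrow> 'a" where
  "slope p q =
    (if 0 \<le> p * q then euclid (nat \<bar>p\<bar>) (nat \<bar>q\<bar>)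
     else half_twist (euclid (nat \<bar>q\<bar>) (nat \<bar>p\<bar>)))"

lemma slope_closed: "slope p q \<in> X"
  by (simp add: slope_def euclid_closed half_twist_closed)

lemma slope_minus: "slope (- p) (- q) = slope p q"
  by (simp add: slope_def)

text \<open>
  At \<open>(0, 0)\<close>, where \<open>euclid\<close> has the default value \<open>a\<close>, the equation would say \<open>a = b\<close>.
\<close>

lemma slope_quarter_turn:
  assumes "p \<noteq> 0 \<or> q \<noteq> 0"
  shows "slope q (- p) = half_twist (slope p q)"
proof (cases "p = 0 \<or> q = 0")
  case True
  with assms show ?thesis
    by (auto simp: slope_def half_twist_a half_twist_b)
next
  case False
  then have "p * q \<noteq> 0" by simp
  then show ?thesis
    by (auto simp: slope_def half_twist_involutive euclid_closed mult.commute)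
qed

text \<open>
  Up to a common sign \<open>q\<close> is nonnegative. The interesting case is then a negative fraction, with
  \<open>m = -p > 0\<close> and \<open>q > 0\<close>, where \<open>\<Psi>(-m, q) * b = \<Delta> (euclid q m * a)\<close>. For \<open>q \<le> m\<close>
  multiplication by \<open>a\<close> undoes the last Euclidean step; for \<open>m < q\<close> the fraction becomes positive, and \<open>x * b * a = \<Delta> (x / a)\<close> produces a second
  half twist that cancels the first.
\<close>

lemma slope_mult_b:
  assumes "p \<noteq> 0 \<or> q \<noteq> 0"
  shows "slope p q \<star> b = slope (p + q) q"
proof -
  have nonneg: "slope p q \<star> b = slope (p + q) q" if "p \<noteq> 0 \<or> q \<noteq> 0" "0 \<le> q" for p q
  proof (cases "0 \<le> p \<or> q = 0")
    case True
    show ?thesis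
    proof (cases "q = 0")
      case True
      with that show ?thesis by (simp add: slope_def idem b_in)
    next
      case False
      with True that have "0 \<le> p" "0 < q" by auto
      then show ?thesis
        using euclid_mult_b[of "nat p" "nat q"] by (simp add: slope_def nat_add_distrib)
    qed
  next
    case False
    define m n where "m = nat (- p)" and "n = nat q"
    from False that have pq: "p = - int m" "q = int n" and pos: "0 < m" "0 < n"
      by (auto simp: m_def n_def)
    have step: "slope p q \<star> b = half_twist (euclid n m \<star> a)"
      using pos by (simp add: slope_def pq half_twist_mult_b euclid_closed
          mult_le_0_iff)
    show ?thesis
    proof (cases "n \<le> m")
      case True
      then have "slope p q \<star> b = half_twist (euclid n (m - n))"
        using step euclid_mult_a[of n "m - n"] by simp
      also have "\<dots> = half_twist (slope q (- (p + q)))"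
        using True pos by (simp add: slope_def pq nat_diff_distrib)
      also have "\<dots> = slope (- (p + q)) (- q)"
        using slope_quarter_turn[of q "- (p + q)"] pos by (simp add: pq)
      also have "\<dots> = slope (p + q) q"
        by (rule slope_minus)
      finally show ?thesis .
    next
      case False
      then have "euclid n m = euclid (n - m) m \<star> b"
        using pos by (simp add: euclid_mult_b)
      moreover have "qdiv (euclid (n - m) m) a = euclid (n - m) n"
        using False euclid_mult_a[of "n - m" m]
        by (metis a_in add.commute euclid_closed le_add_diff_inverse nat_le_linear qdiv_unique)
      ultimately have "slope p q \<star> b = euclid (n - m) n"
        using step by (simp add: mult_b_mult_a half_twist_involutive euclid_closed)
      also have "\<dots> = slope (p + q) q"
        using False by (simp add: slope_def pq nat_diff_distrib)
      finally show ?thesis .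
    qed
  qed
  show ?thesis
  proof (cases "0 \<le> q")
    case True
    with assms show ?thesis by (rule nonneg)
  next
    case False
    then show ?thesis
      using nonneg[of "- p" "- q"] slope_minus[of p q] slope_minus[of "p + q" q] by simp
  qed
qed

text \<open>
  Conjugation by the quarter turn exchanges the two generators.
\<close>

lemma slope_mult_a:
  assumes "p \<noteq> 0 \<or> q \<noteq> 0"
  shows "slope p q \<star> a = slope p (q - p)"
proof -
  have "half_twist (slope p q \<star> a) = slope q (- p) \<star> b"
    using assms by (simp add: slope_quarter_turn half_twist_mult_b slope_closed)
  also have "\<dots> = slope (q - p) (- p)"
    using assms slope_mult_b[of q "- p"] by auto
  also have "\<dots> = half_twist (slope p (q - p))"
    using assms by (intro slope_quarter_turn) auto
  finally show ?thesis
    by (metis a_in closed half_twist_involutive slope_closed)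
qed

text \<open>
  By \<open>slope_minus\<close> the chosen representative does not matter.
\<close>

definition slope_of :: "(int \<times> int) set \<Rightarrow> 'a" where
  "slope_of F = (case SOME x. x \<in> F of (p, q) \<Rightarrow> slope p q)"

lemma slope_of_fraction: "slope_of (fraction p q) = slope p q"
proof -
  have "(SOME x. x \<in> fraction p q) \<in> fraction p q"
    by (rule someI[of _ "(p, q)"]) (simp add: fraction_def)
  then show ?thesis
    by (auto simp: slope_of_def fraction_def slope_minus)
qed

lemma slope_of_closed: "F \<in> fractions \<Longrightarrow> slope_of F \<in> X"
  by (auto simp: fractions_def slope_of_fraction slope_closed)

end


section \<open>The Euclidean algorithm inverts the map to the fractions\<close>

lemma fraction_in_fractions: "coprime p q \<Longrightarrow> fraction p q \<in> fractions"
  by (auto simp: fractions_def)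

locale trefoil_pair_to_fractions =
  trefoil_pair X qop a b + quandle_hom X qop fractions fraction_op f
  for X :: "'a set" and qop :: "'a \<Rightarrow> 'a \<Rightarrow> 'a" (infixl "\<star>" 70)
    and a b :: 'a and f :: "'a \<Rightarrow> (int \<times> int) set" +
  assumes f_a: "f a = fraction 0 1" and f_b: "f b = fraction 1 0"
begin

text \<open>
  For \<open>y * z\<close> the fraction \<open>F\<close> is first divided by \<open>f z\<close>; then both this case and division
  follow from self-distributivity on the two sides.
\<close>

lemma slope_of_mult:
  assumes "y \<in> X" "F \<in> fractions"
  shows "slope_of (fraction_op F (f y)) = slope_of F \<star> y"
  using assms
proof (induction arbitrary: F rule: generated)
  case a
  then obtain p q where F: "F = fraction p q" "coprime p q"
    by (auto simp: fractions_def)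
  then have "p \<noteq> 0 \<or> q \<noteq> 0" by auto
  then show ?case
    by (simp add: F f_a fraction_op_fraction slope_of_fraction slope_mult_a)
next
  case b
  then obtain p q where F: "F = fraction p q" "coprime p q"
    by (auto simp: fractions_def)
  then have "p \<noteq> 0 \<or> q \<noteq> 0" by auto
  then show ?case
    by (simp add: F f_b fraction_op_fraction slope_of_fraction slope_mult_b)
next
  case (mult y z)
  have in_fr: "f y \<in> fractions" "f z \<in> fractions"
    using mult.hyps by (auto simp: maps_to)
  obtain E where E: "E \<in> fractions" "F = fraction_op E (f z)"
    using target.right_div[OF mult.prems in_fr(2)] by auto
  have "fraction_op F (f (y \<star> z)) = fraction_op (fraction_op E (f y)) (f z)"
    using target.self_distrib[OF E(1) in_fr] mult.hyps by (simp add: E hom)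
  then have "slope_of (fraction_op F (f (y \<star> z))) = slope_of E \<star> y \<star> z"
    using mult.IH E in_fr by (simp add: target.closed)
  also have "\<dots> = slope_of F \<star> (y \<star> z)"
    using self_distrib[OF slope_of_closed[OF E(1)] mult.hyps] mult.IH(2)[OF E(1)] by (simp add: E)
  finally show ?case .
next
  case (div y z)
  have in_fr: "f y \<in> fractions" "f z \<in> fractions"
    using div.hyps by (auto simp: maps_to)
  have "slope_of (fraction_op F (f y)) \<star> z = slope_of (fraction_op (fraction_op F (f y)) (f z))"
    using div.IH(2) div.prems in_fr by (simp add: target.closed)
  also have "\<dots> = slope_of (fraction_op (fraction_op F (f z)) (f (y \<star> z)))"
    using target.self_distrib[OF div.prems in_fr] div.hyps by (simp add: hom)
  also have "\<dots> = slope_of F \<star> z \<star> (y \<star> z)"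
    using div.IH div.prems in_fr by (simp add: target.closed)
  also have "\<dots> = slope_of F \<star> y \<star> z"
    using self_distrib[OF slope_of_closed[OF div.prems] div.hyps] by simp
  finally show ?case
    using div.hyps div.prems in_fr
    by (meson closed right_cancel slope_of_closed target.closed)
qed

lemma slope_of_f:
  assumes "x \<in> X"
  shows "slope_of (f x) = x"
  using assms
proof (induction rule: generated)
  case a
  show ?case by (simp add: f_a slope_of_fraction slope_def)
next
  case b
  show ?case by (simp add: f_b slope_of_fraction slope_def)
next
  case (mult x y)
  then show ?case by (simp add: hom slope_of_mult maps_to)
next
  case (div x y)
  then have "slope_of (f x) \<star> y = x \<star> y"
    using slope_of_mult[of y "f x"] by (simp add: hom maps_to)
  with div show ?case
    using right_cancel slope_of_closed maps_to by meson
qed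

lemma f_half_twist:
  assumes "x \<in> X" "f x = fraction p q"
  shows "f (half_twist x) = fraction q (- p)"
  using assms by (simp add: half_twist_def hom closed a_in b_in f_a f_b fraction_op_fraction)

lemma f_euclid:
  assumes "coprime p q"
  shows "f (euclid p q) = fraction (int p) (int q)"
  using assms
proof (induction p q rule: euclid.induct)
  case (1 p q)
  consider "p = 0" | "0 < p" "q = 0" | "0 < q" "q \<le> p" | "0 < p" "p < q"
    by linarith
  then show ?case
  proof cases
    case 1
    with "1.prems" show ?thesis by (simp add: f_a)
  next
    case 2
    with "1.prems" show ?thesis by (simp add: f_b)
  next
    case 3
    then have "coprime (p - q) q"
      using "1.prems" by (metis coprime_iff_gcd_eq_1 gcd_diff1_nat)
    with 3 "1.IH"(1) have "f (euclid (p - q) q) = fraction (int p - int q) (int q)"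
      by (simp add: of_nat_diff)
    then have "f (euclid (p - q) q \<star> b) = fraction (int p) (int q)"
      by (simp add: hom euclid_closed b_in f_b fraction_op_fraction)
    then show ?thesis
      using 3 euclid_mult_b[of "p - q" q] by simp
  next
    case 4
    then have "coprime p (q - p)"
      using "1.prems" by (metis coprime_iff_gcd_eq_1 gcd.commute gcd_diff1_nat less_imp_le)
    with 4 "1.IH"(2) have "f (euclid p (q - p)) = fraction (int p) (int q - int p)"
      by (simp add: of_nat_diff)
    also have "\<dots> = fraction_op (fraction (int p) (int q)) (f a)"
      by (simp add: f_a fraction_op_fraction)
    finally have "fraction_op (f (euclid p q)) (f a) = fraction_op (fraction (int p) (int q)) (f a)"
      using 4 euclid_mult_a[of p "q - p"] hom[OF euclid_closed a_in, of p q] by simp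
    moreover have "fraction (int p) (int q) \<in> fractions"
      using "1.prems" by (simp add: fraction_in_fractions)
    ultimately show ?thesis
      using target.right_cancel maps_to euclid_closed a_in by meson
  qed
qed

lemma f_slope_of:
  assumes "F \<in> fractions"
  shows "f (slope_of F) = F"
proof -
  obtain p q where F: "F = fraction p q" "coprime p q"
    using assms by (auto simp: fractions_def)
  have cop: "coprime (nat \<bar>p\<bar>) (nat \<bar>q\<bar>)"
    using F(2) by (simp add: coprime_int_iff [symmetric])
  show ?thesis
  proof (cases "0 \<le> p * q")
    case True
    then have "fraction \<bar>p\<bar> \<bar>q\<bar> = fraction p q"
      by (auto simp: fraction_eq_iff zero_le_mult_iff)
    with True cop show ?thesis
      by (simp add: F slope_of_fraction slope_def f_euclid)
  next
    case False
    then have "fraction \<bar>p\<bar> (- \<bar>q\<bar>) = fraction p q"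
      by (auto simp: fraction_eq_iff not_le mult_less_0_iff)
    with False cop show ?thesis
      by (simp add: F slope_of_fraction slope_def f_euclid coprime_commute euclid_closed
          f_half_twist[of _ "\<bar>q\<bar>" "\<bar>p\<bar>"])
  qed
qed

lemma bij_betw_fractions: "bij_betw f X fractions"
  by (rule bij_betw_byWitness[where f' = slope_of])
    (auto simp: slope_of_f f_slope_of maps_to slope_of_closed)

end


section \<open>The fundamental quandle of the trefoil\<close>

text \<open>
  Induction on terms: a quotient term is the unique solution of an equation, so the
  division rule for \<open>P\<close> covers the constructor \<open>Div\<close>.
\<close>

lemma presented_quandle_induct [consumes 1, case_names gen mult div]:
  assumes "z \<in> presented_quandle R"
    and gen: "\<And>g. P (qclass R (Gen g))"
    and mult: "\<And>x y. \<lbrakk>x \<in> presented_quandle R; y \<in> presented_quandle R; P x; P y\<rbrakk>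
      \<Longrightarrow> P (presented_op R x y)"
    and div: "\<And>x y. \<lbrakk>x \<in> presented_quandle R; y \<in> presented_quandle R;
      P (presented_op R x y); P y\<rbrakk> \<Longrightarrow> P x"
  shows "P z"
proof -
  have mem: "qclass R t \<in> presented_quandle R" for t
    by (simp add: presented_quandle_eq)
  have "P (qclass R t)" for t
  proof (induction t)
    case (Gen g)
    show ?case by (rule gen)
  next
    case (Op s t)
    then show ?case using mult[OF mem mem, of s t] by (simp add: presented_op_qclass)
  next
    case (Div s t)
    have "presented_op R (qclass R (Div s t)) (qclass R t) = qclass R s"
      by (simp add: presented_op_qclass qclass_eq_iff qcong.Op_Div)
    with Div show ?case using div[OF mem mem, of "Div s t" t] by simp
  qed
  with assms(1) show ?thesis by (auto simp: presented_quandle_eq)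
qed

lemma trefoil_pair_trefoil: "trefoil_pair trefoil_quandle trefoil_op trefoil_a trefoil_b"
proof -
  interpret quandle trefoil_quandle trefoil_op
    unfolding trefoil_quandle_def trefoil_op_def by (rule quandle_presented)
  show ?thesis
  proof
    show "trefoil_a \<in> trefoil_quandle" "trefoil_b \<in> trefoil_quandle"
      by (simp_all add: trefoil_a_def trefoil_b_def trefoil_quandle_def presented_quandle_eq)
    show "trefoil_op (trefoil_op trefoil_a trefoil_b) trefoil_a = trefoil_b"
      "trefoil_op (trefoil_op trefoil_b trefoil_a) trefoil_b = trefoil_a"
      by (auto simp: trefoil_a_def trefoil_b_def trefoil_op_def presented_op_qclass qclass_eq_iff
          trefoil_rels_def intro: qcong.rel)
  next
    fix z and P :: "trefoil_gen qterm set \<Rightarrow> bool"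
    assume z: "z \<in> trefoil_quandle" and gens: "P trefoil_a" "P trefoil_b"
      and mult: "\<And>x y. \<lbrakk>x \<in> trefoil_quandle; y \<in> trefoil_quandle; P x; P y\<rbrakk>
        \<Longrightarrow> P (trefoil_op x y)"
      and div: "\<And>x y. \<lbrakk>x \<in> trefoil_quandle; y \<in> trefoil_quandle;
        P (trefoil_op x y); P y\<rbrakk> \<Longrightarrow> P x"
    have "P (qclass trefoil_rels (Gen g))" for g
      using gens by (cases g) (simp_all add: trefoil_a_def trefoil_b_def)
    then show "P z"
      using z mult div presented_quandle_induct[of z trefoil_rels P]
      unfolding trefoil_quandle_def trefoil_op_def by blast
  qed
qed

theorem theorem3p2:
  shows "\<exists>\<phi>. quandle_iso trefoil_quandle trefoil_op fractions fraction_op \<phi> \<and>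
      \<phi> trefoil_a = fraction 0 1 \<and> \<phi> trefoil_b = fraction 1 0 \<and>
      (\<forall>\<psi>. quandle_hom trefoil_quandle trefoil_op fractions fraction_op \<psi> \<and>
          \<psi> trefoil_a = fraction 0 1 \<and> \<psi> trefoil_b = fraction 1 0 \<longrightarrow>
        (\<forall>x\<in>trefoil_quandle. \<psi> x = \<phi> x))"
proof -
  interpret F: quandle fractions fraction_op
    by (rule quandle_fractions)
  define h where "h g = (case g of Gen_a \<Rightarrow> fraction 0 1 | Gen_b \<Rightarrow> fraction 1 0)" for g
  have "h g \<in> fractions" for g
    by (cases g) (simp_all add: h_def fraction_in_fractions)
  moreover have "F.qeval h s = F.qeval h t" if "(s, t) \<in> trefoil_rels" for s t
    using that unfolding trefoil_rels_def
    by (elim insertE emptyE) (simp_all add: h_def fraction_op_fraction fraction_eq_iff)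
  ultimately obtain \<phi> where
    phi_hom: "quandle_hom trefoil_quandle trefoil_op fractions fraction_op \<phi>"
    and gens: "\<And>g. \<phi> (qclass trefoil_rels (Gen g)) = h g"
    unfolding trefoil_quandle_def trefoil_op_def
    using F.presented_universal[of h trefoil_rels] by blast
  have ab: "\<phi> trefoil_a = fraction 0 1" "\<phi> trefoil_b = fraction 1 0"
    using gens[of Gen_a] gens[of Gen_b] by (simp_all add: trefoil_a_def trefoil_b_def h_def)
  interpret trefoil_pair_to_fractions trefoil_quandle trefoil_op trefoil_a trefoil_b \<phi>
    using trefoil_pair_trefoil phi_hom ab
    by (simp add: trefoil_pair_to_fractions_def trefoil_pair_to_fractions_axioms_def)
  have "quandle_iso trefoil_quandle trefoil_op fractions fraction_op \<phi>"
    using phi_hom bij_betw_fractions by (simp add: quandle_iso_def quandle_iso_axioms_def)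
  moreover have "\<psi> x = \<phi> x"
    if \<psi>: "quandle_hom trefoil_quandle trefoil_op fractions fraction_op \<psi>"
      "\<psi> trefoil_a = fraction 0 1" "\<psi> trefoil_b = fraction 1 0"
      and x: "x \<in> trefoil_quandle" for \<psi> x
  proof (rule presented_hom_unique[of trefoil_rels fractions fraction_op])
    show "\<psi> (qclass trefoil_rels (Gen g)) = \<phi> (qclass trefoil_rels (Gen g))" for g
      using \<psi>(2,3) ab by (cases g) (simp_all add: trefoil_a_def trefoil_b_def)
  qed (use \<psi>(1) phi_hom x in \<open>simp_all add: trefoil_quandle_def trefoil_op_def\<close>)
  ultimately show ?thesis
    using ab by blast
qed

end
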